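(* There is an absolute constant $k>0$ such that for the Cesaro operator $C:C[0,1]\to C[0,1]$, every $m\in\mathbb{N}$, every $x\in[0,1]$ and every $f\in C[0,1]$, $$|C^m(f;x)-f(0)|\le k\,\omega_2\bigl(f,\sqrt{\lambda_m(x)}\bigr)+k\,\|f\|\,\delta_m(x),$$ where $$\lambda_m(x)=\max\left\{\frac{x}{2^m},\frac{x^2}{3^m}\right\},\qquad \delta_m(x)=\frac{x}{2^m}.$$
   Context: $C[0,1]$ is the space of real-valued continuous functions on $[0,1]$ with the supremum norm $\|\cdot\|$. The Cesaro operator $C:C[0,1]\to C[0,1]$ is defined by $C(f;0)=f(0)$ and $C(f;x)=\frac1x\int_0^x f(s)\,ds$ for $0<x\le 1$; $C(f;x)$ is the value of $C(f)$ at $x$, and $C^m$ is the $m$-fold composition of $C$. The second modulus of smoothness of $f$ is $\omega_2(f,t)=\sup_{0<h\le t}\ \sup_{0\le x\le 1-2h}|f(x+2h)-2f(x+h)+f(x)|$ for $t\ge 0$, with the convention that a supremum over an empty set is $0$. "Absolute constant" means independent of $m$, $x$ and $f$. *)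

theory Defs
  imports "HOL-Analysis.Analysis"
begin

text \<open>
  An element of \<open>C[0,1]\<close> is represented by any \<open>f :: real \<Rightarrow> real\<close> with
  \<open>continuous_on {0..1} f\<close>. All notions below, evaluated at points of \<open>{0..1}\<close>,
  depend only on the values of \<open>f\<close> on \<open>{0..1}\<close>.
\<close>

definition sup_norm :: "(real \<Rightarrow> real) \<Rightarrow> real" where
  "sup_norm f = (SUP x\<in>{0..1}. \<bar>f x\<bar>)"

definition cesaro :: "(real \<Rightarrow> real) \<Rightarrow> real \<Rightarrow> real" where
  "cesaro f x = (if x = 0 then f 0 else (1 / x) * integral {0..x} f)"

text \<open>
  The library leaves the value of \<open>Sup {}\<close> on \<^typ>\<open>real\<close> unspecified; here it has to be \<open>0\<close>.
\<close>

definition sup_zero :: "real set \<Rightarrow> real" where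
  "sup_zero S = (if S = {} then 0 else Sup S)"

definition second_modulus :: "(real \<Rightarrow> real) \<Rightarrow> real \<Rightarrow> real" where
  "second_modulus f t =
     sup_zero ((\<lambda>h. sup_zero ((\<lambda>x. \<bar>f (x + 2 * h) - 2 * f (x + h) + f x\<bar>) ` {0..1 - 2 * h}))
       ` {0<..t})"

definition cesaro_lambda :: "nat \<Rightarrow> real \<Rightarrow> real" where
  "cesaro_lambda m x = max (x / 2 ^ m) (x\<^sup>2 / 3 ^ m)"

definition cesaro_delta :: "nat \<Rightarrow> real \<Rightarrow> real" where
  "cesaro_delta m x = x / 2 ^ m"

lemma continuous_on_cesaro:
  assumes f: "continuous_on {0..1} f"
  shows "continuous_on {0..1} (cesaro f)"
proof -
  define F where "F = (\<lambda>x. integral {0..x} f)"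
  have D: "(F has_real_derivative f x) (at x within {0..1})" if "x \<in> {0..1}" for x
    unfolding F_def using integral_has_real_derivative[OF f that] .
  have "continuous (at x within {0..1}) (cesaro f)" if x: "x \<in> {0..1}" for x
  proof (cases "x = 0")
    case True
    have "((\<lambda>y. (F y - F 0) / (y - 0)) \<longlongrightarrow> f 0) (at 0 within {0..1})"
      using D[of 0] by (simp add: has_field_derivative_iff)
    moreover have "\<forall>\<^sub>F y in at 0 within {0..1}. (F y - F 0) / (y - 0) = cesaro f y"
      by (auto simp: eventually_at_filter cesaro_def F_def)
    ultimately have "(cesaro f \<longlongrightarrow> f 0) (at 0 within {0..1})"
      using Lim_transform_eventually by blast
    then show ?thesis
      by (simp add: True continuous_within cesaro_def)
  next
    case False
    have "(F \<longlongrightarrow> F x) (at x within {0..1})"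
      using DERIV_continuous[OF D[OF x]] by (simp add: continuous_within)
    then have "((\<lambda>y. (1 / y) * F y) \<longlongrightarrow> (1 / x) * F x) (at x within {0..1})"
      using False by (intro tendsto_intros) auto
    moreover have "\<forall>\<^sub>F y in at x within {0..1}. y \<noteq> 0"
      using False x by (intro tendsto_imp_eventually_ne[OF tendsto_ident_at])
    then have "\<forall>\<^sub>F y in at x within {0..1}. (1 / y) * F y = cesaro f y"
      by eventually_elim (simp add: cesaro_def F_def)
    ultimately have "(cesaro f \<longlongrightarrow> (1 / x) * F x) (at x within {0..1})"
      using Lim_transform_eventually by blast
    then show ?thesis
      using False by (simp add: continuous_within cesaro_def F_def)
  qed
  then show ?thesis
    by (simp add: continuous_on_eq_continuous_within)
qed

end

theory Submission
  imports Defs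
begin

text \<open>
  The functional \<open>f \<mapsto> C\<^sup>m(f;x)\<close> is an average against a probability measure on \<open>[0,1]\<close> whose
  first two moments are \<open>x/2\<^sup>m\<close> and \<open>x\<^sup>2/3\<^sup>m\<close>. Hence it suffices to sandwich \<open>f\<close> between parabolas:
  \<open>\<bar>f(y) - f(0) - ay\<bar> \<le> A + Dy\<^sup>2\<close> on \<open>[0,1]\<close> implies
  \<open>\<bar>C\<^sup>m(f;x) - f(0) - ax/2\<^sup>m\<bar> \<le> A + Dx\<^sup>2/3\<^sup>m\<close> (lemma \<open>cesaro_funpow_near_linear\<close>).

  The parabolas come from the second differences alone, without passing through smooth
  approximations of \<open>f\<close>. Fix \<open>0 < h \<le> 1/2\<close>, let \<open>W\<close> bound all second differences of step at most
  \<open>h\<close>, and let \<open>f(0) + ay\<close> interpolate \<open>f\<close> at \<open>0\<close> and \<open>2h\<close>. On \<open>[0,2h]\<close> the interpolation error is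
  at most \<open>W\<close> (\<open>chord_error_le_second_difference\<close>), and from there summing second differences
  twice makes it grow at most quadratically: it is at most \<open>2W(1 + y\<^sup>2/h\<^sup>2)\<close> on \<open>[0,1]\<close>
  (\<open>quadratic_growth\<close>). Reading this at \<open>y = 1\<close>, where \<open>f\<close> is bounded by \<open>\<parallel>f\<parallel>\<close>, bounds the slope
  by \<open>\<bar>a\<bar> \<le> 2\<parallel>f\<parallel> + 4W/h\<^sup>2\<close>.

  Taking \<open>h\<close> proportional to \<open>\<surd>\<lambda>\<^sub>m(x)\<close> balances everything: both \<open>x/2\<^sup>m\<close> and \<open>x\<^sup>2/3\<^sup>m\<close> are at most
  \<open>\<lambda>\<^sub>m(x)\<close>, so that all terms containing \<open>W/h\<^sup>2\<close> become multiples of \<open>W\<close>, and only \<open>2\<parallel>f\<parallel>\<delta>\<^sub>m(x)\<close>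
  remains besides.
\<close>

text \<open>
  Integrating the bounds termwise: the Cesaro operator multiplies \<open>y\<close> by \<open>1/2\<close> and \<open>y\<^sup>2\<close> by \<open>1/3\<close>.
\<close>

lemma cesaro_near_linear:
  assumes f: "continuous_on {0..1} f"
    and bd: "\<And>y. y \<in> {0..1} \<Longrightarrow> \<bar>f y - c - a * y\<bar> \<le> A + D * y\<^sup>2"
    and x: "x \<in> {0..1}"
  shows "\<bar>cesaro f x - c - (a / 2) * x\<bar> \<le> A + (D / 3) * x\<^sup>2"
proof (cases "x = 0")
  case True
  then show ?thesis using bd[of 0] by (simp add: cesaro_def)
next
  case False
  with x have x0: "0 < x" "x \<le> 1" by auto
  have int_quadratic: "((\<lambda>y. p + q * y + r * y\<^sup>2) has_integral (x * (p + q / 2 * x + r / 3 * x\<^sup>2))) {0..x}"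
    for p q r :: real
  proof -
    have "((\<lambda>y. p + q * y + r * y\<^sup>2) has_integral
        (p * x + q / 2 * x\<^sup>2 + r / 3 * x^3 - (p * 0 + q / 2 * 0\<^sup>2 + r / 3 * 0^3))) {0..x}"
      using x0
      by (intro fundamental_theorem_of_calculus)
         (auto intro!: derivative_eq_intros
           simp flip: has_real_derivative_iff_has_vector_derivative)
    then show ?thesis
      by (simp add: algebra_simps power2_eq_square power3_eq_cube)
  qed
  have "continuous_on {0..x} f"
    using f x0 by (auto intro: continuous_on_subset)
  then have F: "(f has_integral integral {0..x} f) {0..x}"
    by (intro integrable_integral integrable_continuous_real)
  have "integral {0..x} f \<le> x * ((c + A) + a / 2 * x + D / 3 * x\<^sup>2)"
  proof (rule has_integral_le[OF F int_quadratic])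
    fix y assume "y \<in> {0..x}"
    then show "f y \<le> (c + A) + a * y + D * y\<^sup>2" using bd[of y] x0 by auto
  qed
  then have up: "cesaro f x \<le> (c + A) + a / 2 * x + D / 3 * x\<^sup>2"
    using x0 by (simp add: cesaro_def divide_le_eq mult.commute)
  have "x * ((c - A) + a / 2 * x + (- D) / 3 * x\<^sup>2) \<le> integral {0..x} f"
  proof (rule has_integral_le[OF int_quadratic F])
    fix y assume "y \<in> {0..x}"
    then show "(c - A) + a * y + (- D) * y\<^sup>2 \<le> f y" using bd[of y] x0 by auto
  qed
  then have lo: "(c - A) + a / 2 * x + (- D) / 3 * x\<^sup>2 \<le> cesaro f x"
    using x0 by (simp add: cesaro_def le_divide_eq mult.commute)
  from up lo show ?thesis by (simp add: abs_le_iff)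
qed

lemma continuous_on_cesaro_funpow:
  "continuous_on {0..1} f \<Longrightarrow> continuous_on {0..1} ((cesaro ^^ m) f)"
  by (induction m) (auto intro: continuous_on_cesaro)

lemma cesaro_funpow_near_linear:
  assumes f: "continuous_on {0..1} f"
    and bd: "\<And>y. y \<in> {0..1} \<Longrightarrow> \<bar>f y - c - a * y\<bar> \<le> A + D * y\<^sup>2"
    and x: "x \<in> {0..1}"
  shows "\<bar>(cesaro ^^ m) f x - c - (a / 2 ^ m) * x\<bar> \<le> A + (D / 3 ^ m) * x\<^sup>2"
  using x
proof (induction m arbitrary: x)
  case 0
  then show ?case using bd by simp
next
  case (Suc m)
  show ?case
    using cesaro_near_linear[OF continuous_on_cesaro_funpow[OF f] Suc.IH Suc.prems]
    by (simp add: mult.commute)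
qed

text \<open>
  At a point \<open>p\<close> where \<open>\<bar>g\<bar>\<close> is maximal, the second difference centred at \<open>p\<close> that reaches to the
  nearer endpoint involves one zero of \<open>g\<close> and one value no larger than \<open>\<bar>g p\<bar>\<close>.
\<close>

lemma chord_error_le_second_difference:
  fixes g :: "real \<Rightarrow> real"
  assumes g: "continuous_on {0..2 * h} g" and h: "0 < h"
    and g0: "g 0 = 0" and g2h: "g (2 * h) = 0"
    and W: "\<And>s u. 0 < s \<Longrightarrow> s \<le> h \<Longrightarrow> 0 \<le> u \<Longrightarrow> u + 2 * s \<le> 2 * h \<Longrightarrow>
              \<bar>g (u + 2 * s) - 2 * g (u + s) + g u\<bar> \<le> W"
    and y: "y \<in> {0..2 * h}"
  shows "\<bar>g y\<bar> \<le> W"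
proof -
  have "continuous_on {0..2 * h} (\<lambda>y. \<bar>g y\<bar>)" using g by (intro continuous_intros)
  then obtain p where p: "p \<in> {0..2 * h}" and pmax: "\<And>y. y \<in> {0..2 * h} \<Longrightarrow> \<bar>g y\<bar> \<le> \<bar>g p\<bar>"
    using continuous_attains_sup[of "{0..2 * h}" "\<lambda>y. \<bar>g y\<bar>"] h by auto
  have W0: "0 \<le> W" using W[of h 0] h by force
  have "\<bar>g p\<bar> \<le> W"
  proof -
    consider "p = 0" | "p = 2 * h" | "0 < p" "p \<le> h" | "h \<le> p" "p < 2 * h"
      using p by fastforce
    then show ?thesis
    proof cases
      case 3
      then show ?thesis using W[of p 0] pmax[of "2 * p"] g0 by auto
    next
      case 4
      then have "\<bar>g (2 * h) - 2 * g p + g (2 * p - 2 * h)\<bar> \<le> W"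
        using W[of "2 * h - p" "2 * p - 2 * h"] by (simp add: algebra_simps)
      then show ?thesis using 4 pmax[of "2 * p - 2 * h"] g2h by auto
    qed (use W0 g0 g2h in auto)
  qed
  then show ?thesis using pmax[OF y] by linarith
qed

text \<open>
  Bounds on second differences of the single step \<open>h\<close>, summed twice, starting from a bound on two
  consecutive intervals of length \<open>h\<close>.
\<close>

lemma quadratic_growth:
  fixes g :: "real \<Rightarrow> real"
  assumes h: "0 < h" and W0: "0 \<le> W"
    and start: "\<And>y. 0 \<le> y \<Longrightarrow> y \<le> 2 * h \<Longrightarrow> \<bar>g y\<bar> \<le> W"
    and W: "\<And>u. 0 \<le> u \<Longrightarrow> u + 2 * h \<le> b \<Longrightarrow> \<bar>g (u + 2 * h) - 2 * g (u + h) + g u\<bar> \<le> W"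
    and y: "0 \<le> y" "y \<le> b"
  shows "\<bar>g y\<bar> \<le> 2 * W + (2 * W / h\<^sup>2) * y\<^sup>2"
proof -
  \<comment> \<open>The first differences grow linearly; carrying them along makes the induction go through.\<close>
  have cells: "\<bar>g (v + h) - g v\<bar> \<le> (real n + 2) * W \<and> \<bar>g (v + h)\<bar> \<le> (real n + 2)\<^sup>2 * W"
    if "real n * h \<le> v" "v \<le> (real n + 1) * h" "v + h \<le> b" for n v
    using that
  proof (induction n arbitrary: v)
    case 0
    then have "\<bar>g v\<bar> \<le> W" "\<bar>g (v + h)\<bar> \<le> W" using start[of v] start[of "v + h"] h by auto
    then show ?case using W0 by auto
  next
    case (Suc n)
    define u where "u = v - h"
    have u: "real n * h \<le> u" "u \<le> (real n + 1) * h" "u + h \<le> b" "v = u + h"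
      using Suc.prems h by (auto simp: u_def algebra_simps)
    then have u0: "0 \<le> u" using h by (smt (verit) mult_nonneg_nonneg of_nat_0_le_iff)
    have IH: "\<bar>g v - g u\<bar> \<le> (real n + 2) * W" "\<bar>g v\<bar> \<le> (real n + 2)\<^sup>2 * W"
      using Suc.IH[OF u(1-3)] u(4) by auto
    have "\<bar>g (v + h) - 2 * g v + g u\<bar> \<le> W"
      using W[OF u0] Suc.prems(3) u(4) by (simp add: algebra_simps)
    then have d: "\<bar>g (v + h) - g v\<bar> \<le> (real n + 3) * W"
      using IH(1) by (simp add: algebra_simps abs_le_iff)
    have "\<bar>g (v + h)\<bar> \<le> ((real n + 2)\<^sup>2 + (real n + 3)) * W"
      using d IH(2) by (simp add: algebra_simps abs_le_iff)
    also have "\<dots> \<le> (real n + 3)\<^sup>2 * W"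
      using W0 by (intro mult_right_mono) (auto simp: power2_eq_square algebra_simps)
    finally show ?case using d by (simp add: add.commute add.left_commute)
  qed
  have step: "\<bar>g y\<bar> \<le> (y / h + 1)\<^sup>2 * W"
  proof (cases "y \<le> h")
    case True
    then have "\<bar>g y\<bar> \<le> 1\<^sup>2 * W" using start[of y] y h by auto
    also have "\<dots> \<le> (y / h + 1)\<^sup>2 * W"
      using y h W0 by (intro mult_right_mono power_mono) auto
    finally show ?thesis .
  next
    case False
    define n where "n = nat \<lfloor>y / h - 1\<rfloor>"
    have "0 \<le> y / h - 1" using False h by (simp add: field_simps)
    then have "real n = of_int \<lfloor>y / h - 1\<rfloor>" by (simp add: n_def)
    then have n: "real n \<le> y / h - 1" "y / h - 1 \<le> real n + 1" by linarith+
    have "\<bar>g ((y - h) + h)\<bar> \<le> (real n + 2)\<^sup>2 * W"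
      using cells[of n "y - h"] n y h by (simp add: field_simps)
    also have "\<dots> \<le> (y / h + 1)\<^sup>2 * W"
      using n W0 by (intro mult_right_mono power_mono) auto
    finally show ?thesis by simp
  qed
  have "(r + 1)\<^sup>2 \<le> 2 + 2 * r\<^sup>2" for r :: real
    using zero_le_power2[of "r - 1"] by (simp add: power2_eq_square algebra_simps)
  then have "(y / h + 1)\<^sup>2 * W \<le> (2 + 2 * (y / h)\<^sup>2) * W"
    using W0 by (rule mult_right_mono)
  with step show ?thesis by (simp add: power_divide algebra_simps)
qed

lemma abs_le_sup_norm:
  assumes "continuous_on {0..1} f" "y \<in> {0..1}"
  shows "\<bar>f y\<bar> \<le> sup_norm f"
proof -
  have "continuous_on {0..1} (\<lambda>x. \<bar>f x\<bar>)" using assms(1) by (intro continuous_intros)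
  then have "bdd_above ((\<lambda>x. \<bar>f x\<bar>) ` {0..1})"
    by (intro bounded_imp_bdd_above compact_imp_bounded compact_continuous_image) auto
  then show ?thesis unfolding sup_norm_def using assms(2) by (intro cSUP_upper)
qed

lemma sup_zero_upper:
  assumes "\<And>s. s \<in> S \<Longrightarrow> s \<le> B" "s \<in> S"
  shows "s \<le> sup_zero S"
  using assms by (auto simp: sup_zero_def intro!: cSup_upper bdd_aboveI)

lemma sup_zero_least:
  assumes "\<And>s. s \<in> S \<Longrightarrow> s \<le> B" "0 \<le> B"
  shows "sup_zero S \<le> B"
  using assms by (auto simp: sup_zero_def intro!: cSup_least)

lemma second_difference_le_second_modulus:
  assumes f: "continuous_on {0..1} f"
    and h: "0 < h" "h \<le> t" and u: "0 \<le> u" "u + 2 * h \<le> 1"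
  shows "\<bar>f (u + 2 * h) - 2 * f (u + h) + f u\<bar> \<le> second_modulus f t"
proof -
  let ?D = "\<lambda>h x. \<bar>f (x + 2 * h) - 2 * f (x + h) + f x\<bar>"
  let ?S = "\<lambda>h. sup_zero (?D h ` {0..1 - 2 * h})"
  have D: "?D s x \<le> 4 * sup_norm f" if "0 < s" "x \<in> {0..1 - 2 * s}" for s x
    using abs_le_sup_norm[OF f, of x] abs_le_sup_norm[OF f, of "x + s"]
      abs_le_sup_norm[OF f, of "x + 2 * s"] that by auto
  have norm0: "0 \<le> sup_norm f" using abs_le_sup_norm[OF f, of 0] by simp
  have "?D h u \<le> ?S h"
    using D[OF h(1)] u by (intro sup_zero_upper[where B = "4 * sup_norm f"]) auto
  also have "?S h \<le> second_modulus f t"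
    unfolding second_modulus_def
  proof (rule sup_zero_upper[where B = "4 * sup_norm f"])
    fix s assume "s \<in> ?S ` {0<..t}"
    then show "s \<le> 4 * sup_norm f"
      using D norm0 by (auto intro!: sup_zero_least)
  qed (use h in auto)
  finally show ?thesis .
qed

text \<open>
  The quantitative core: a chord of \<open>f\<close> starting at \<open>0\<close> serves as a tangent line there, with an
  explicit control of its slope.
\<close>

lemma near_linear_at_zero:
  fixes f :: "real \<Rightarrow> real"
  assumes f: "continuous_on {0..1} f" and h: "0 < h" "2 * h \<le> 1"
    and W: "\<And>s u. 0 < s \<Longrightarrow> s \<le> h \<Longrightarrow> 0 \<le> u \<Longrightarrow> u + 2 * s \<le> 1 \<Longrightarrow>
              \<bar>f (u + 2 * s) - 2 * f (u + s) + f u\<bar> \<le> W"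
  obtains a where "\<bar>a\<bar> \<le> 2 * sup_norm f + 4 * W / h\<^sup>2"
    and "\<And>y. y \<in> {0..1} \<Longrightarrow> \<bar>f y - f 0 - a * y\<bar> \<le> 2 * W + (2 * W / h\<^sup>2) * y\<^sup>2"
proof -
  define a where "a = (f (2 * h) - f 0) / (2 * h)"
  define g where "g y = f y - f 0 - a * y" for y
  have W0: "0 \<le> W" using W[of h 0] h by force
  have "continuous_on {0..2 * h} f" using f by (rule continuous_on_subset) (use h in auto)
  then have g: "continuous_on {0..2 * h} g" unfolding g_def by (intro continuous_intros)
  have same: "g (u + 2 * s) - 2 * g (u + s) + g u = f (u + 2 * s) - 2 * f (u + s) + f u" for u s
    by (simp add: g_def algebra_simps)
  have start: "\<bar>g y\<bar> \<le> W" if "0 \<le> y" "y \<le> 2 * h" for y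
  proof (rule chord_error_le_second_difference[OF g h(1)])
    show "g 0 = 0" "g (2 * h) = 0" using h by (auto simp: g_def a_def)
    show "\<bar>g (u + 2 * s) - 2 * g (u + s) + g u\<bar> \<le> W"
      if "0 < s" "s \<le> h" "0 \<le> u" "u + 2 * s \<le> 2 * h" for s u
      unfolding same using W[of s u] that h by simp
  qed (use that in auto)
  have growth: "\<bar>g y\<bar> \<le> 2 * W + (2 * W / h\<^sup>2) * y\<^sup>2" if "y \<in> {0..1}" for y
  proof (rule quadratic_growth[OF h(1) W0 start])
    show "\<bar>g (u + 2 * h) - 2 * g (u + h) + g u\<bar> \<le> W" if "0 \<le> u" "u + 2 * h \<le> 1" for u
      unfolding same using W[of h u] that h by simp
  qed (use that in auto)
  have "h\<^sup>2 \<le> 1" using h by (intro power_le_one) auto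
  then have "2 * W \<le> 2 * W / h\<^sup>2" using h W0 by (simp add: le_divide_eq mult_left_le)
  then have "\<bar>f 1 - f 0 - a\<bar> \<le> 4 * W / h\<^sup>2" using growth[of 1] by (simp add: g_def)
  then have "\<bar>a\<bar> \<le> 2 * sup_norm f + 4 * W / h\<^sup>2"
    using abs_le_sup_norm[OF f, of 0] abs_le_sup_norm[OF f, of 1] by auto
  then show ?thesis using growth that by (simp add: g_def)
qed

theorem theorem11:
  shows "\<exists>k::real. k > 0 \<and>
    (\<forall>(m::nat) (x::real) (f::real \<Rightarrow> real).
       x \<in> {0..1} \<longrightarrow> continuous_on {0..1} f \<longrightarrow>
       \<bar>(cesaro ^^ m) f x - f 0\<bar>
         \<le> k * second_modulus f (sqrt (cesaro_lambda m x)) + k * sup_norm f * cesaro_delta m x)"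
  \<comment> \<open>\<open>26 = 10 + 16\<close>: the deviation of \<open>f\<close> from the chord contributes \<open>10\<close> moduli, the slope \<open>16\<close>.\<close>
proof (intro exI[of _ 26] conjI allI impI)
  fix m :: nat and x :: real and f :: "real \<Rightarrow> real"
  assume x: "x \<in> {0..1}" and f: "continuous_on {0..1} f"
  define L where "L = cesaro_lambda m x"
  define W where "W = second_modulus f (sqrt L)"
  define d where "d = x / 2 ^ m"
  have N0: "0 \<le> sup_norm f" using abs_le_sup_norm[OF f, of 0] by simp
  have "\<bar>(cesaro ^^ m) f x - f 0\<bar> \<le> 26 * W + 2 * sup_norm f * d"
  proof (cases "x = 0")
    case True
    \<comment> \<open>Here the step vanishes and the modulus is a supremum over the empty set.\<close>
    have "(cesaro ^^ m) f 0 = f 0" by (induction m) (auto simp: cesaro_def)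
    moreover have "W = 0"
      using True by (simp add: W_def L_def cesaro_lambda_def second_modulus_def sup_zero_def)
    ultimately show ?thesis using True by (simp add: d_def)
  next
    case False
    then have x0: "0 < x" "x \<le> 1" using x by auto
    have "x\<^sup>2 \<le> 1" using x0 by (intro power_le_one) auto
    then have L: "d \<le> L" "x\<^sup>2 / 3 ^ m \<le> L" "L \<le> 1" "0 < L" "0 \<le> d"
      using x0 order_trans[OF x0(2) one_le_power[of "2::real" m]]
        order_trans[OF _ one_le_power[of "3::real" m], of "x\<^sup>2"]
      by (auto simp: L_def d_def cesaro_lambda_def less_max_iff_disj divide_le_eq)
    \<comment> \<open>Half of the modulus' argument, so that two steps still fit into \<open>[0,1]\<close>.\<close>
    define h where "h = sqrt L / 2"
    have h: "0 < h" "2 * h \<le> 1" "h \<le> sqrt L" using L by (auto simp: h_def)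
    have h2: "h\<^sup>2 = L / 4" using L by (simp add: h_def power_divide)
    have W: "\<bar>f (u + 2 * s) - 2 * f (u + s) + f u\<bar> \<le> W"
      if "0 < s" "s \<le> h" "0 \<le> u" "u + 2 * s \<le> 1" for s u
      unfolding W_def using that h by (intro second_difference_le_second_modulus[OF f]) auto
    have W0: "0 \<le> W" using W[of h 0] h by force
    obtain a where a: "\<bar>a\<bar> \<le> 2 * sup_norm f + 4 * W / h\<^sup>2"
      and near: "\<And>y. y \<in> {0..1} \<Longrightarrow> \<bar>f y - f 0 - a * y\<bar> \<le> 2 * W + (2 * W / h\<^sup>2) * y\<^sup>2"
      using near_linear_at_zero[OF f h(1,2) W] by blast
    have "\<bar>(cesaro ^^ m) f x - f 0 - a * d\<bar> \<le> 2 * W + (8 * W / L) * (x\<^sup>2 / 3 ^ m)"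
      using cesaro_funpow_near_linear[OF f near x, of m] by (simp add: d_def h2 mult.commute)
    also have "(8 * W / L) * (x\<^sup>2 / 3 ^ m) \<le> (8 * W / L) * L"
      using L W0 by (intro mult_left_mono) auto
    also have "(8 * W / L) * L = 8 * W" using L by simp
    finally have approx: "\<bar>(cesaro ^^ m) f x - f 0 - a * d\<bar> \<le> 10 * W" by simp
    have "\<bar>a * d\<bar> \<le> (2 * sup_norm f + 16 * W / L) * d"
      using a L by (simp add: abs_mult h2 mult_right_mono)
    also have "\<dots> = 2 * sup_norm f * d + (16 * W / L) * d" by (simp add: distrib_right)
    also have "(16 * W / L) * d \<le> (16 * W / L) * L"
      using L W0 by (intro mult_left_mono) auto
    also have "(16 * W / L) * L = 16 * W" using L by simp
    finally show ?thesis using approx by linarith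
  qed
  also have "\<dots> \<le> 26 * W + 26 * sup_norm f * d"
    using N0 x by (simp add: d_def divide_right_mono mult_right_mono)
  finally show "\<bar>(cesaro ^^ m) f x - f 0\<bar>
      \<le> 26 * second_modulus f (sqrt (cesaro_lambda m x)) + 26 * sup_norm f * cesaro_delta m x"
    by (simp add: W_def L_def d_def cesaro_delta_def)
qed simp

end
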